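(* Let $S_1,\ldots,S_k$ ($k\ge 1$) be numerical semigroups with multiplicity $m$ and let $F=\max\{\mathrm{F}(S_1),\ldots,\mathrm{F}(S_k)\}$. Then $$\langle S_1,\ldots,S_k\rangle=\Big\{\bigcap_{b\in B}T_b\ \Big|\ \emptyset\neq B\subseteq\{1,\ldots,k\}\text{ and }T_b\in\Omega(S_b)\text{ for all }b\in B\Big\}.$$
   Context: $\mathbb{N}$ is the set of nonnegative integers. A numerical semigroup is a submonoid $S$ of $(\mathbb{N},+)$ with $\mathbb{N}\setminus S$ finite. Its Frobenius number $\mathrm{F}(S)$ is the largest integer not in $S$, and its multiplicity is $\mathrm{m}(S)=\min(S\setminus\{0\})$. If $S\neq\mathbb{N}$, the ratio of $S$ is $\mathrm{r}(S)=\min\{s\in S\mid \mathrm{m}(S)\nmid s\}$ (equivalently, the smallest minimal generator of $S$ different from $\mathrm{m}(S)$). A ratio-covariety is a nonempty family $\mathscr{R}$ of numerical semigroups such that: 1) $\mathscr{R}$ has a minimum with respect to inclusion, denoted $\min(\mathscr{R})$; 2) if $S,T\in\mathscr{R}$ then $S\cap T\in\mathscr{R}$; 3) if $S\in\mathscr{R}$ and $S\neq\min(\mathscr{R})$, then $S\setminus\{\mathrm{r}(S)\}\in\mathscr{R}$ (in particular $\mathrm{r}(S)$ is defined, i.e. $S\neq\mathbb{N}$). $\Delta(F,m)=\langle m\rangle\cup\{n\in\mathbb{N}\mid n\ge F+1\}$, where $\langle m\rangle$ is the set of nonnegative multiples of $m$. For $S_1,\ldots,S_k$ with multiplicity $m$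 and $F=\max\{\mathrm{F}(S_1),\ldots,\mathrm{F}(S_k)\}$, $\langle S_1,\ldots,S_k\rangle$ denotes the intersection of all ratio-covarieties that contain $\{S_1,\ldots,S_k\}$ and have $\Delta(F,m)$ as minimum. For each $i\in\{1,\ldots,k\}$ define recursively $S_i^0=S_i$ and, for $n\in\mathbb{N}$, $S_i^{n+1}=S_i^n\setminus\{\mathrm{r}(S_i^n)\}$ if $S_i^n\neq\Delta(F,m)$, and $S_i^{n+1}=\Delta(F,m)$ otherwise. There is a least $P_i\in\mathbb{N}$ with $S_i^{P_i}=\Delta(F,m)$, and $\Omega(S_i)=\{S_i^0,S_i^1,\ldots,S_i^{P_i}\}$. *)

theory Defs
  imports Main
begin

definition numerical_semigroup :: "nat set \<Rightarrow> bool" where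
  "numerical_semigroup S \<longleftrightarrow>
     0 \<in> S \<and> (\<forall>x\<in>S. \<forall>y\<in>S. x + y \<in> S) \<and> finite (UNIV - S)"

(* Integer-valued, ranging over all integers, so that the value at S = UNIV is -1. *)
definition frobenius_number :: "nat set \<Rightarrow> int" where
  "frobenius_number S = (GREATEST z::int. z \<notin> int ` S)"

definition ns_multiplicity :: "nat set \<Rightarrow> nat" where
  "ns_multiplicity S = (LEAST s. s \<in> S - {0})"

(* Meaningful only for numerical semigroups S \<noteq> UNIV. *)
definition ns_ratio :: "nat set \<Rightarrow> nat" where
  "ns_ratio S = (LEAST s. s \<in> S \<and> \<not> ns_multiplicity S dvd s)"

definition has_minimum :: "nat set set \<Rightarrow> bool" where
  "has_minimum R \<longleftrightarrow> (\<exists>M\<in>R. \<forall>S\<in>R. M \<subseteq> S)"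

(* LEAST refers to the inclusion order on sets. *)
definition family_min :: "nat set set \<Rightarrow> nat set" where
  "family_min R = (LEAST M. M \<in> R)"

(* The conjunct S \<noteq> UNIV says that the ratio of S is defined. *)
definition ratio_covariety :: "nat set set \<Rightarrow> bool" where
  "ratio_covariety R \<longleftrightarrow>
     R \<noteq> {} \<and> (\<forall>S\<in>R. numerical_semigroup S) \<and>
     has_minimum R \<and>
     (\<forall>S\<in>R. \<forall>T\<in>R. S \<inter> T \<in> R) \<and>
     (\<forall>S\<in>R. S \<noteq> family_min R \<longrightarrow> S \<noteq> UNIV \<and> S - {ns_ratio S} \<in> R)"

definition Delta :: "int \<Rightarrow> nat \<Rightarrow> nat set" where
  "Delta F m = {n. m dvd n} \<union> {n. int n \<ge> F + 1}"

definition generated_family :: "int \<Rightarrow> nat \<Rightarrow> nat set set \<Rightarrow> nat set set" where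
  "generated_family F m A =
     \<Inter> {R. ratio_covariety R \<and> A \<subseteq> R \<and> family_min R = Delta F m}"

primrec ratio_chain :: "int \<Rightarrow> nat \<Rightarrow> nat set \<Rightarrow> nat \<Rightarrow> nat set" where
  "ratio_chain F m S 0 = S"
| "ratio_chain F m S (Suc n) =
     (if ratio_chain F m S n \<noteq> Delta F m
      then ratio_chain F m S n - {ns_ratio (ratio_chain F m S n)}
      else Delta F m)"

definition chain_length :: "int \<Rightarrow> nat \<Rightarrow> nat set \<Rightarrow> nat" where
  "chain_length F m S = (LEAST p. ratio_chain F m S p = Delta F m)"

definition Omega :: "int \<Rightarrow> nat \<Rightarrow> nat set \<Rightarrow> nat set set" where
  "Omega F m S = ratio_chain F m S ` {0..chain_length F m S}"

end

theory Submission
  imports Defs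
begin

text \<open>
  Deleting the ratio from a numerical semigroup \<open>X\<close> of multiplicity \<open>m\<close> deletes its smallest
  element that is not a multiple of \<open>m\<close>. So a repeated deletion removes precisely the non-multiples
  of \<open>m\<close> below some threshold \<open>t\<close>, and \<open>\<Omega>(S)\<close> consists of the sets \<open>trim m t S\<close> obtained from \<open>S\<close>
  in this way with \<open>t \<le> F + 1\<close>, the last one being \<open>\<Delta>(F, m)\<close> (lemma \<open>Omega_eq_trims\<close>).

  In this description everything becomes transparent, because trimming commutes with intersections
  and two trimmings compose to the one with the larger threshold. The family \<open>\<R>\<close> of all
  intersections \<open>\<Inter>b\<in>B. T b\<close> with \<open>T b \<in> \<Omega>(S b)\<close> is closed under intersection, since each
  \<open>\<Omega>(S b)\<close> is a chain. It is closed under deletion of the ratio \<open>r\<close>, since deleting \<open>r\<close> from an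
  intersection amounts to trimming all of its members at \<open>r + 1\<close>; here \<open>r \<le> F\<close> as long as the
  intersection differs from \<open>\<Delta>(F, m)\<close>. Hence \<open>\<R>\<close> is itself a ratio-covariety with minimum
  \<open>\<Delta>(F, m)\<close> (lemma \<open>ratio_covariety_intersections\<close>). Conversely, a ratio-covariety with this
  minimum that contains the \<open>S i\<close> contains their chains, and thus the finite intersections of chain
  members (lemma \<open>intersections_in_ratio_covariety\<close>).
\<close>

section \<open>Multiplicity and Frobenius number\<close>

lemma ns_multiplicityI:
  assumes "m \<in> X" "m > 0" "\<And>x. x \<in> X \<Longrightarrow> x \<noteq> 0 \<Longrightarrow> m \<le> x"
  shows "ns_multiplicity X = m"
  unfolding ns_multiplicity_def using assms by (intro Least_equality) auto

lemma
  assumes "numerical_semigroup S"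
  shows ns_multiplicity_in: "ns_multiplicity S \<in> S"
    and ns_multiplicity_pos: "ns_multiplicity S > 0"
proof -
  have "infinite S"
    using assms by (metis finite_Diff2 infinite_UNIV_nat numerical_semigroup_def)
  then have "\<exists>s. s \<in> S - {0}"
    by (metis Diff_empty ex_in_conv finite.emptyI infinite_remove)
  then have "ns_multiplicity S \<in> S - {0}"
    unfolding ns_multiplicity_def by (rule LeastI_ex)
  then show "ns_multiplicity S \<in> S" "ns_multiplicity S > 0" by auto
qed

lemma ns_multiplicity_le:
  "x \<in> S \<Longrightarrow> x \<noteq> 0 \<Longrightarrow> ns_multiplicity S \<le> x"
  unfolding ns_multiplicity_def by (rule Least_le) auto

lemma numerical_semigroup_multiples:
  assumes "numerical_semigroup S" "m \<in> S" "m dvd n"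
  shows "n \<in> S"
proof -
  have "m * j \<in> S" for j
    using assms(1,2) by (induction j) (auto simp: numerical_semigroup_def)
  then show ?thesis using assms(3) by auto
qed

lemma
  assumes "numerical_semigroup S"
  shows frobenius_number_ge: "frobenius_number S \<ge> -1"
    and above_frobenius_number: "int n > frobenius_number S \<Longrightarrow> n \<in> S"
proof -
  \<comment> \<open>All negative integers are gaps, so \<open>-1\<close> is the largest gap if there is none among the naturals.\<close>
  let ?A = "insert (-1) (int ` (UNIV - S))"
  have fin: "finite ?A" using assms by (simp add: numerical_semigroup_def)
  have eq: "frobenius_number S = Max ?A"
    unfolding frobenius_number_def
  proof (rule Greatest_equality)
    show "Max ?A \<notin> int ` S" using Max_in[OF fin] by auto
  next
    fix z assume z: "z \<notin> int ` S"
    show "z \<le> Max ?A"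
    proof (cases "z \<ge> 0")
      case True
      then obtain n where "z = int n" by (metis nonneg_int_cases)
      then have "z \<in> ?A" using z by auto
      then show ?thesis using fin by (rule Max_ge[rotated])
    next
      case False
      then have "z \<le> -1" by simp
      also have "\<dots> \<le> Max ?A" using fin by (rule Max_ge) simp
      finally show ?thesis .
    qed
  qed
  show "frobenius_number S \<ge> -1" unfolding eq using fin by (rule Max_ge) simp
  show "n \<in> S" if "int n > frobenius_number S"
  proof (rule ccontr)
    assume "n \<notin> S"
    then have "int n \<le> Max ?A" using fin by (intro Max_ge) auto
    then show False using that eq by simp
  qed
qed

lemma Delta_subset:
  assumes "numerical_semigroup S" "frobenius_number S \<le> F"
  shows "Delta F (ns_multiplicity S) \<subseteq> S"
  using assms numerical_semigroup_multiples[OF assms(1) ns_multiplicity_in[OF assms(1)]]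
    above_frobenius_number[OF assms(1)]
  by (fastforce simp: Delta_def)

lemma numerical_semigroup_Inter:
  assumes "finite B" "B \<noteq> {}" "\<And>b. b \<in> B \<Longrightarrow> numerical_semigroup (T b)"
  shows "numerical_semigroup (\<Inter>b\<in>B. T b)"
proof -
  have "finite (\<Union>b\<in>B. UNIV - T b)"
    using assms(1,3) by (intro finite_UN_I) (auto simp: numerical_semigroup_def)
  also have "(\<Union>b\<in>B. UNIV - T b) = UNIV - (\<Inter>b\<in>B. T b)" by auto
  finally show ?thesis using assms(3) by (auto simp: numerical_semigroup_def)
qed

lemma ns_multiplicity_Inter:
  assumes "B \<noteq> {}" "\<And>b. b \<in> B \<Longrightarrow> numerical_semigroup (T b)"
    "\<And>b. b \<in> B \<Longrightarrow> ns_multiplicity (T b) = m"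
  shows "ns_multiplicity (\<Inter>b\<in>B. T b) = m"
proof (rule ns_multiplicityI)
  show "m \<in> (\<Inter>b\<in>B. T b)" using assms ns_multiplicity_in by fastforce
  show "m > 0" using assms ns_multiplicity_pos by fastforce
  show "m \<le> x" if "x \<in> (\<Inter>b\<in>B. T b)" "x \<noteq> 0" for x
    using assms that ns_multiplicity_le by fastforce
qed

section \<open>Trimming\<close>

definition trim :: "nat \<Rightarrow> nat \<Rightarrow> nat set \<Rightarrow> nat set" where
  "trim m t X = {x \<in> X. m dvd x \<or> t \<le> x}"

lemma trim_0: "trim m 0 X = X"
  by (auto simp: trim_def)

lemma trim_trim: "trim m u (trim m t X) = trim m (max t u) X"
  by (auto simp: trim_def)

lemma trim_Int_trim: "trim m t X \<inter> trim m u X = trim m (max t u) X"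
  by (auto simp: trim_def)

lemma trim_INT: "trim m t (\<Inter>b\<in>B. T b) = (\<Inter>b\<in>B. trim m t (T b))" if "B \<noteq> {}"
  using that by (auto simp: trim_def)

lemma numerical_semigroup_trim:
  assumes "numerical_semigroup X"
  shows "numerical_semigroup (trim m t X)"
proof -
  have "UNIV - trim m t X \<subseteq> (UNIV - X) \<union> {..<t}" by (auto simp: trim_def)
  then have "finite (UNIV - trim m t X)"
    by (rule finite_subset) (use assms in \<open>simp add: numerical_semigroup_def\<close>)
  then show ?thesis using assms by (auto simp: trim_def numerical_semigroup_def)
qed

lemma ns_multiplicity_trim:
  assumes "numerical_semigroup X" "ns_multiplicity X = m"
  shows "ns_multiplicity (trim m t X) = m"
  using assms ns_multiplicity_in[of X] ns_multiplicity_pos[of X] ns_multiplicity_le[of _ X]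
  by (intro ns_multiplicityI) (auto simp: trim_def)

lemma trim_eq_Delta:
  assumes "Delta F m \<subseteq> S" "int t = F + 1"
  shows "trim m t S = Delta F m"
proof -
  have "t \<le> n \<longleftrightarrow> F + 1 \<le> int n" for n using assms(2) by linarith
  then show ?thesis using assms(1) by (auto simp: trim_def Delta_def)
qed

lemma Delta_subset_trim:
  assumes "Delta F m \<subseteq> S" "int t \<le> F + 1"
  shows "Delta F m \<subseteq> trim m t S"
  using assms by (auto simp: trim_def Delta_def)

text \<open>
  The ratio is the least element that is not a multiple of \<open>m\<close>, so only the multiples of \<open>m\<close> are
  left below it.
\<close>

lemma remove_ratio_eq_trim:
  assumes "ns_multiplicity X = m" "s \<in> X" "\<not> m dvd s"
  shows "X - {ns_ratio X} = trim m (Suc (ns_ratio X)) X"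
proof -
  let ?r = "ns_ratio X"
  have r: "\<not> m dvd ?r"
    unfolding ns_ratio_def assms(1) using LeastI[of "\<lambda>s. s \<in> X \<and> \<not> m dvd s" s] assms by blast
  have le: "?r \<le> x" if "x \<in> X" "\<not> m dvd x" for x
    unfolding ns_ratio_def assms(1) using that by (intro Least_le) auto
  show ?thesis
    using r le by (fastforce simp: trim_def Suc_le_eq order.strict_iff_order)
qed

text \<open>
  The bound on the threshold guarantees that deleting the ratio never leaves the sets above
  \<open>\<Delta>(F, m)\<close>.
\<close>

lemma remove_ratio_above_Delta:
  assumes "ns_multiplicity X = m" "Delta F m \<subseteq> X" "X \<noteq> Delta F m"
  obtains t where "X - {ns_ratio X} = trim m t X" "int t \<le> F + 1"
proof -
  obtain s where s: "s \<in> X" "\<not> m dvd s" "int s \<le> F"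
    using assms(2,3) by (force simp: Delta_def)
  have "ns_ratio X \<le> s"
    unfolding ns_ratio_def assms(1) using s by (intro Least_le) auto
  then have "int (Suc (ns_ratio X)) \<le> F + 1" using s(3) by simp
  then show thesis using that remove_ratio_eq_trim[OF assms(1) s(1,2)] by blast
qed

section \<open>The chain of a semigroup\<close>

lemma ratio_chain_is_trim:
  assumes "numerical_semigroup S" "ns_multiplicity S = m" "Delta F m \<subseteq> S" "F \<ge> -1"
  shows "\<exists>t. int t \<le> F + 1 \<and> ratio_chain F m S n = trim m t S"
proof (induction n)
  case 0
  show ?case using assms(4) by (intro exI[of _ 0]) (simp add: trim_0)
next
  case (Suc n)
  then obtain t where t: "int t \<le> F + 1" "ratio_chain F m S n = trim m t S" by blast
  show ?case
  proof (cases "ratio_chain F m S n = Delta F m")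
    case True
    then show ?thesis using t by auto
  next
    case False
    then obtain u where u: "int u \<le> F + 1"
      "trim m t S - {ns_ratio (trim m t S)} = trim m u (trim m t S)"
      using remove_ratio_above_Delta[OF ns_multiplicity_trim[OF assms(1,2)]
          Delta_subset_trim[OF assms(3) t(1)]] t(2) by metis
    then have "ratio_chain F m S (Suc n) = trim m (max t u) S"
      using False t(2) by (simp add: trim_trim)
    moreover have "int (max t u) \<le> F + 1" using t(1) u(1) by simp
    ultimately show ?thesis by blast
  qed
qed

text \<open>
  Raising the threshold from \<open>t\<close> to \<open>t + 1\<close> has an effect only if \<open>t\<close> is an element and no multiple
  of \<open>m\<close>; then \<open>t\<close> is the current ratio, and the chain takes one step.
\<close>

lemma trim_in_ratio_chain:
  assumes "numerical_semigroup S" "ns_multiplicity S = m" "int t \<le> F + 1"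
  shows "\<exists>n. trim m t S = ratio_chain F m S n"
  using assms(3)
proof (induction t)
  case 0
  show ?case by (metis ratio_chain.simps(1) trim_0)
next
  case (Suc t)
  then obtain n where n: "trim m t S = ratio_chain F m S n" by auto
  show ?case
  proof (cases "t \<in> S \<and> \<not> m dvd t")
    case False
    then have "trim m (Suc t) S = trim m t S"
      by (auto simp: trim_def Suc_le_eq order.strict_iff_order)
    then show ?thesis using n by auto
  next
    case True
    then have t: "t \<in> trim m t S" by (simp add: trim_def)
    have mult: "ns_multiplicity (trim m t S) = m" by (rule ns_multiplicity_trim[OF assms(1,2)])
    have ratio: "ns_ratio (trim m t S) = t"
      unfolding ns_ratio_def mult using t True by (intro Least_equality) (auto simp: trim_def)
    have "trim m t S - {t} = trim m (Suc t) (trim m t S)"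
      using remove_ratio_eq_trim[OF mult t] True ratio by simp
    also have "\<dots> = trim m (Suc t) S" by (simp add: trim_trim max_def)
    finally have "trim m (Suc t) S = trim m t S - {ns_ratio (trim m t S)}" by (simp add: ratio)
    moreover have "trim m t S \<noteq> Delta F m"
      using t True Suc.prems by (auto simp: Delta_def)
    ultimately have "trim m (Suc t) S = ratio_chain F m S (Suc n)" by (simp add: n)
    then show ?thesis by blast
  qed
qed

lemma ratio_chain_stays_Delta:
  assumes "ratio_chain F m S p = Delta F m" "p \<le> n"
  shows "ratio_chain F m S n = Delta F m"
  using assms(2) by (induction rule: dec_induct) (simp_all add: assms(1))

text \<open>
  The chain is constant once it has reached \<open>\<Delta>(F, m)\<close>, so stopping it there loses no member.
\<close>

lemma Omega_eq_range:
  assumes "ratio_chain F m S p = Delta F m"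
  shows "Omega F m S = range (ratio_chain F m S)"
proof -
  let ?P = "chain_length F m S"
  have P: "ratio_chain F m S ?P = Delta F m"
    unfolding chain_length_def using assms by (rule LeastI)
  have "ratio_chain F m S n \<in> Omega F m S" for n
    unfolding Omega_def using P ratio_chain_stays_Delta[OF P, of n]
    by (cases "n \<le> ?P") (auto intro: image_eqI[of _ _ ?P])
  then show ?thesis unfolding Omega_def by blast
qed

lemma Omega_eq_trims:
  assumes "numerical_semigroup S" "ns_multiplicity S = m" "Delta F m \<subseteq> S" "F \<ge> -1"
  shows "Omega F m S = {trim m t S | t. int t \<le> F + 1}"
proof -
  have "int (nat (F + 1)) = F + 1" using assms(4) by simp
  then obtain p where "ratio_chain F m S p = Delta F m"
    using trim_in_ratio_chain[OF assms(1,2), of "nat (F + 1)" F] trim_eq_Delta[OF assms(3)]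
    by fastforce
  then have "Omega F m S = range (ratio_chain F m S)" by (rule Omega_eq_range)
  then show ?thesis
    using ratio_chain_is_trim[OF assms] trim_in_ratio_chain[OF assms(1,2)] by fastforce
qed

section \<open>Intersections of chain members\<close>

lemma family_minI:
  assumes "M \<in> R" "\<And>X. X \<in> R \<Longrightarrow> M \<subseteq> X"
  shows "family_min R = M"
  unfolding family_min_def using assms by (intro Least_equality)

definition chain_intersections :: "int \<Rightarrow> nat \<Rightarrow> 'a set \<Rightarrow> ('a \<Rightarrow> nat set) \<Rightarrow> nat set set" where
  "chain_intersections F m I S =
     {(\<Inter>b\<in>B. T b) | B T. B \<noteq> {} \<and> B \<subseteq> I \<and> (\<forall>b\<in>B. T b \<in> Omega F m (S b))}"

lemma chain_intersectionsI:
  assumes "B \<noteq> {}" "B \<subseteq> I" "\<And>b. b \<in> B \<Longrightarrow> T b \<in> Omega F m (S b)"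
  shows "(\<Inter>b\<in>B. T b) \<in> chain_intersections F m I S"
  unfolding chain_intersections_def using assms by blast

lemma Omega_subset_chain_intersections:
  assumes "i \<in> I" "X \<in> Omega F m (S i)"
  shows "X \<in> chain_intersections F m I S"
  using chain_intersectionsI[of "{i}" I "\<lambda>_. X" F m S] assms by simp

lemma chain_subset_ratio_covariety:
  assumes "ratio_covariety R" "family_min R = Delta F m" "S \<in> R"
  shows "ratio_chain F m S n \<in> R"
  using assms by (induction n) (auto simp: ratio_covariety_def)

lemma intersections_in_ratio_covariety:
  assumes "ratio_covariety R" "family_min R = Delta F m" "S ` I \<subseteq> R" "finite I"
  shows "chain_intersections F m I S \<subseteq> R"
proof
  fix X assume "X \<in> chain_intersections F m I S"
  then obtain B T where B: "B \<noteq> {}" "B \<subseteq> I" "\<forall>b\<in>B. T b \<in> Omega F m (S b)"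
    and X: "X = (\<Inter>b\<in>B. T b)"
    unfolding chain_intersections_def by blast
  have "finite B" using B(2) assms(4) by (rule finite_subset)
  moreover note B(1)
  moreover have "T b \<in> R" if "b \<in> B" for b
  proof -
    have "S b \<in> R" using that B(2) assms(3) by blast
    then have "Omega F m (S b) \<subseteq> R"
      unfolding Omega_def using chain_subset_ratio_covariety[OF assms(1,2)] by blast
    then show ?thesis using that B(3) by blast
  qed
  ultimately have "(\<Inter>b\<in>B. T b) \<in> R"
  proof (induction B rule: finite_ne_induct)
    case (singleton x)
    then show ?case by simp
  next
    case (insert x B)
    then show ?case using assms(1) by (simp add: ratio_covariety_def)
  qed
  then show "X \<in> R" by (simp add: X)
qed

text \<open>
  Each closure property is obtained member by member from a property of the chains: trimming and
  binary intersection stay inside \<open>\<Omega>(S i)\<close>, and both pass through \<open>\<Inter>\<close>.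
\<close>

lemma ratio_covariety_intersections:
  assumes "I \<noteq> {}" "finite I" "F \<ge> -1"
    and sg: "\<And>i. i \<in> I \<Longrightarrow> numerical_semigroup (S i)"
    and mult: "\<And>i. i \<in> I \<Longrightarrow> ns_multiplicity (S i) = m"
    and Delta: "\<And>i. i \<in> I \<Longrightarrow> Delta F m \<subseteq> S i"
  shows "ratio_covariety (chain_intersections F m I S)"
    and "family_min (chain_intersections F m I S) = Delta F m"
proof -
  let ?R = "chain_intersections F m I S"
  have Omega: "Omega F m (S i) = {trim m t (S i) | t. int t \<le> F + 1}" if "i \<in> I" for i
    using that by (intro Omega_eq_trims sg mult Delta assms(3))
  have Omega_sg: "numerical_semigroup X" and Omega_mult: "ns_multiplicity X = m"
    and Omega_Delta: "Delta F m \<subseteq> X" if iX: "i \<in> I" "X \<in> Omega F m (S i)" for i X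
  proof -
    obtain t where t: "X = trim m t (S i)" "int t \<le> F + 1"
      using iX(2) unfolding Omega[OF iX(1)] by blast
    show "numerical_semigroup X"
      unfolding t(1) using sg[OF iX(1)] by (rule numerical_semigroup_trim)
    show "ns_multiplicity X = m"
      unfolding t(1) using sg[OF iX(1)] mult[OF iX(1)] by (rule ns_multiplicity_trim)
    show "Delta F m \<subseteq> X"
      unfolding t(1) using Delta[OF iX(1)] t(2) by (rule Delta_subset_trim)
  qed
  have Omega_trim: "trim m t X \<in> Omega F m (S i)"
    if iX: "i \<in> I" "X \<in> Omega F m (S i)" "int t \<le> F + 1" for i X t
  proof -
    obtain u where u: "X = trim m u (S i)" "int u \<le> F + 1"
      using iX(2) unfolding Omega[OF iX(1)] by blast
    have "int (max u t) \<le> F + 1" using u(2) iX(3) by simp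
    then show ?thesis unfolding u(1) trim_trim Omega[OF iX(1)] by blast
  qed
  have Omega_Int: "X \<inter> Y \<in> Omega F m (S i)"
    if iX: "i \<in> I" "X \<in> Omega F m (S i)" "Y \<in> Omega F m (S i)" for i X Y
  proof -
    obtain t u where tu: "X = trim m t (S i)" "Y = trim m u (S i)"
      and "int t \<le> F + 1" "int u \<le> F + 1"
      using iX(2,3) unfolding Omega[OF iX(1)] by blast
    then have "int (max t u) \<le> F + 1" by simp
    then show ?thesis unfolding tu trim_Int_trim Omega[OF iX(1)] by blast
  qed
  have R_E: "\<exists>B T. B \<noteq> {} \<and> B \<subseteq> I \<and> (\<forall>b\<in>B. T b \<in> Omega F m (S b)) \<and> X = (\<Inter>b\<in>B. T b)"
    if "X \<in> ?R" for X
    using that unfolding chain_intersections_def by blast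
  have R_sg: "numerical_semigroup X" and R_mult: "ns_multiplicity X = m"
    and R_Delta: "Delta F m \<subseteq> X" if "X \<in> ?R" for X
  proof -
    obtain B T where B: "B \<noteq> {}" "B \<subseteq> I" "\<forall>b\<in>B. T b \<in> Omega F m (S b)"
      and X: "X = (\<Inter>b\<in>B. T b)"
      using R_E[OF \<open>X \<in> ?R\<close>] by blast
    have "finite B" using B(2) assms(2) by (rule finite_subset)
    then show "numerical_semigroup X"
      unfolding X using B Omega_sg by (intro numerical_semigroup_Inter) auto
    show "ns_multiplicity X = m"
      unfolding X using B Omega_sg Omega_mult by (intro ns_multiplicity_Inter) blast+
    show "Delta F m \<subseteq> X"
      unfolding X using B Omega_Delta by blast
  qed
  obtain i where i: "i \<in> I" using assms(1) by blast
  have last: "int (nat (F + 1)) = F + 1" using assms(3) by simp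
  have "trim m (nat (F + 1)) (S i) \<in> Omega F m (S i)"
    unfolding Omega[OF i] using last by force
  then have "Delta F m \<in> Omega F m (S i)"
    by (simp only: trim_eq_Delta[OF Delta[OF i] last])
  then have Delta_R: "Delta F m \<in> ?R" by (rule Omega_subset_chain_intersections[OF i])
  show min: "family_min ?R = Delta F m" using Delta_R R_Delta by (rule family_minI)
  have Int: "X \<inter> Y \<in> ?R" if "X \<in> ?R" "Y \<in> ?R" for X Y
  proof -
    obtain B T where B: "B \<noteq> {}" "B \<subseteq> I" "\<forall>b\<in>B. T b \<in> Omega F m (S b)" "X = (\<Inter>b\<in>B. T b)"
      using R_E[OF \<open>X \<in> ?R\<close>] by blast
    obtain C U where C: "C \<noteq> {}" "C \<subseteq> I" "\<forall>b\<in>C. U b \<in> Omega F m (S b)" "Y = (\<Inter>b\<in>C. U b)"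
      using R_E[OF \<open>Y \<in> ?R\<close>] by blast
    \<comment> \<open>An index in only one of \<open>B\<close> and \<open>C\<close> keeps its member; one in both gets the smaller of the two.\<close>
    define V where "V b = (if b \<in> B then T b else UNIV) \<inter> (if b \<in> C then U b else UNIV)" for b
    have "X \<inter> Y = (\<Inter>b\<in>B \<union> C. V b)" unfolding B(4) C(4) V_def by (auto split: if_splits)
    also have "\<dots> \<in> ?R"
    proof (rule chain_intersectionsI)
      show "V b \<in> Omega F m (S b)" if "b \<in> B \<union> C" for b
        using that B(2,3) C(2,3) Omega_Int[of b "T b" "U b"] unfolding V_def by auto
    qed (use B(1,2) C(1,2) in auto)
    finally show ?thesis .
  qed
  have remove: "X \<noteq> UNIV \<and> X - {ns_ratio X} \<in> ?R" if X: "X \<in> ?R" "X \<noteq> Delta F m" for X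
  proof
    \<comment> \<open>The only semigroup without a ratio has multiplicity 1, and then it is \<open>\<Delta>(F, 1)\<close>.\<close>
    show "X \<noteq> UNIV"
    proof
      assume "X = UNIV"
      then have "m = 1" using R_mult[OF X(1)] ns_multiplicityI[of 1 UNIV] by simp
      then show False using X(2) \<open>X = UNIV\<close> by (simp add: Delta_def)
    qed
    obtain t where t: "X - {ns_ratio X} = trim m t X" "int t \<le> F + 1"
      using remove_ratio_above_Delta[OF R_mult[OF X(1)] R_Delta[OF X(1)] X(2)] by blast
    obtain B T where B: "B \<noteq> {}" "B \<subseteq> I" "\<forall>b\<in>B. T b \<in> Omega F m (S b)" "X = (\<Inter>b\<in>B. T b)"
      using R_E[OF \<open>X \<in> ?R\<close>] by blast
    have "trim m t X = (\<Inter>b\<in>B. trim m t (T b))" using B(1,4) trim_INT by simp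
    also have "\<dots> \<in> ?R" using B(1-3) Omega_trim t(2) by (intro chain_intersectionsI) auto
    finally show "X - {ns_ratio X} \<in> ?R" using t(1) by simp
  qed
  show "ratio_covariety ?R"
    unfolding ratio_covariety_def min
  proof (intro conjI ballI impI)
    show "?R \<noteq> {}" using Delta_R by auto
    show "has_minimum ?R" unfolding has_minimum_def using Delta_R R_Delta by blast
  qed (simp_all add: R_sg Int remove)
qed

theorem proposition7p6:
  fixes k m :: nat and F :: int and S :: "nat \<Rightarrow> nat set"
  assumes "k \<ge> 1"
    and "\<And>i. i \<in> {1..k} \<Longrightarrow> numerical_semigroup (S i)"
    and "\<And>i. i \<in> {1..k} \<Longrightarrow> ns_multiplicity (S i) = m"
    and "F = Max ((\<lambda>i. frobenius_number (S i)) ` {1..k})"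
  shows "generated_family F m (S ` {1..k}) =
    {(\<Inter>b\<in>B. T b) | B T.
       B \<noteq> {} \<and> B \<subseteq> {1..k} \<and> (\<forall>b\<in>B. T b \<in> Omega F m (S b))}"
proof -
  let ?R = "chain_intersections F m {1..k} S"
  have F: "frobenius_number (S i) \<le> F" if "i \<in> {1..k}" for i
    unfolding assms(4) using that by (intro Max_ge) auto
  have Delta: "Delta F m \<subseteq> S i" if "i \<in> {1..k}" for i
    using Delta_subset[OF assms(2) F, of i] assms(3) that by simp
  have ne: "{1..k} \<noteq> {}" using assms(1) by simp
  have F1: "F \<ge> -1"
    using frobenius_number_ge[OF assms(2), of 1] F[of 1] assms(1) by simp
  note R = ratio_covariety_intersections[OF ne finite_atLeastAtMost F1 assms(2,3) Delta]
  have "S i \<in> Omega F m (S i)" for i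
    unfolding Omega_def by (rule image_eqI[of _ _ 0]) simp_all
  then have "S ` {1..k} \<subseteq> ?R"
    by (intro image_subsetI) (rule Omega_subset_chain_intersections)
  then have "generated_family F m (S ` {1..k}) \<subseteq> ?R"
    unfolding generated_family_def using R by (intro Inter_lower) simp
  moreover have "?R \<subseteq> generated_family F m (S ` {1..k})"
    unfolding generated_family_def
    by (intro Inter_greatest) (simp add: intersections_in_ratio_covariety)
  ultimately show ?thesis unfolding chain_intersections_def by (rule subset_antisym)
qed

end
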